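(* Let $k\in\mathbb N^+$, let $H$ be a nontrivial $k$-monoid and let $X\subseteq I_k$ be maximal independent over $H$. Then $$\mathrm{ind}\,H=|X|=\mathrm{free}\,H.$$ Moreover, if $H$ is finitely generated, then $$\mathrm{ind}\,H=\mathrm{rank}\,M^H.$$
   Context: $\mathbb N=\{0,1,2,\ldots\}$, $\mathbb N^+=\mathbb N\setminus\{0\}$, $I_k=\{1,\ldots,k\}$. Elements $h\in\mathbb N^k$ are regarded as functions $h:I_k\to\mathbb N$, i.e. $h=(h(1),\ldots,h(k))$; $0_k$ is the zero element. A $k$-monoid is a submonoid of $(\mathbb N^k,+)$; it is nontrivial if it is not $\{0_k\}$. An isomorphism between a $k$-monoid and an $l$-monoid is a bijective additive map; $\cong$ denotes isomorphism. Index: $\mathrm{ind}\,H=\min\{r\in\mathbb N^+: H\cong K\text{ for some }r\text{-monoid }K\}$. Independence: for a nonempty $A\subseteq\mathbb N^k$ and $i\in I_k$ let $\alpha_i^A\in\mathbb Q^A$ (the $\mathbb Q$-vector space of functions $A\to\mathbb Q$) be given by $\alpha_i^A(f)=f(i)$. A nonempty $X\subseteq I_k$ is independent over $A$ if $\{\alpha_i^A\}_{i\in X}$ is linearly independent in $\mathbb Q^A$ (as a family indexed by $X$), and maximal independent over $A$ if it is independent over $A$ and no $Y\subseteq I_k$ with $X\subsetneq Y$ is independent over $A$. Minimal generators: with $H^*=H\setminus\{0_k\}$, $\beta(H)=H^*\setminus(H^*+H^* )$ is the unique minimal generating set of $H$. For finitely generated $H$, $\dim H=|\beta(H)|$. A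 $k$-monoid $F$ is free if every element of $F$ is uniquely a finite $\mathbb N$-linear combination of elements of $\beta(F)$ (i.e. $F$ is a free commutative monoid; free $k$-monoids are finitely generated). $\mathrm{free}\,H=\max\{\dim F: F\subseteq H\text{ a submonoid},\ F\text{ free}\}$. Matrix: if $H$ is finitely generated with $\beta(H)=\{h_1,\ldots,h_r\}$, $r=\dim H$, then $M^H$ is the $k\times r$ matrix whose $(i,j)$ entry is $h_j(i)$ (defined up to ordering of $\beta(H)$), and $\mathrm{rank}\,M^H$ is its rank over $\mathbb Q$. *)

theory Defs
  imports "HOL-Library.Function_Algebras" "Jordan_Normal_Form.DL_Rank"
begin

text \<open>
  Vectors of varying lengths share the type \<^typ>\<open>nat \<Rightarrow> nat\<close>: a vector of length \<open>k\<close> is a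
  function that vanishes outside \<open>{1..k}\<close>. Addition is pointwise, from \<open>Function_Algebras\<close>.
  A \<open>k\<close>-monoid is a set \<open>H\<close> with \<open>submonoid H (natvec k)\<close>; as a monoid of its own it is
  \<open>natvec k\<lparr>carrier := H\<rparr>\<close>.
\<close>

definition natvec :: "nat \<Rightarrow> (nat \<Rightarrow> nat) monoid" where
  "natvec k = \<lparr>carrier = {h. \<forall>i. i \<notin> {1..k} \<longrightarrow> h i = 0}, monoid.mult = (+), one = 0\<rparr>"

lemma comm_monoid_natvec: "comm_monoid (natvec k)"
  by unfold_locales (auto simp: natvec_def add.assoc add.commute)

text \<open>
  The relation \<open>\<cong>\<close> does not ask for preservation of the unit, which is automatic for
  bijective additive maps between these monoids.
\<close>

definition ind :: "nat \<Rightarrow> (nat \<Rightarrow> nat) set \<Rightarrow> nat" where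
  "ind k H = (LEAST r. 1 \<le> r \<and>
     (\<exists>K. submonoid K (natvec r) \<and> natvec k\<lparr>carrier := H\<rparr> \<cong> natvec r\<lparr>carrier := K\<rparr>))"

text \<open>
  The rational vector space of functions on \<open>A\<close> is the space of functions on the whole type
  that vanish outside \<open>A\<close>.
\<close>

definition ratfun_scale :: "rat \<Rightarrow> ((nat \<Rightarrow> nat) \<Rightarrow> rat) \<Rightarrow> (nat \<Rightarrow> nat) \<Rightarrow> rat" where
  "ratfun_scale q F = (\<lambda>f. q * F f)"

interpretation ratfun: Vector_Spaces.vector_space ratfun_scale
  by unfold_locales (auto simp: ratfun_scale_def fun_eq_iff algebra_simps)

definition coord :: "(nat \<Rightarrow> nat) set \<Rightarrow> nat \<Rightarrow> (nat \<Rightarrow> nat) \<Rightarrow> rat" where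
  "coord A i = (\<lambda>f. if f \<in> A then of_nat (f i) else 0)"

text \<open>
  Independence is that of the family indexed by \<open>X\<close>, so coinciding coordinate functions at
  distinct indices count as dependent: hence the injectivity.
\<close>

definition indep_over :: "nat \<Rightarrow> (nat \<Rightarrow> nat) set \<Rightarrow> nat set \<Rightarrow> bool" where
  "indep_over k A X \<longleftrightarrow> X \<noteq> {} \<and> X \<subseteq> {1..k} \<and>
     inj_on (coord A) X \<and> ratfun.independent (coord A ` X)"

definition max_indep_over :: "nat \<Rightarrow> (nat \<Rightarrow> nat) set \<Rightarrow> nat set \<Rightarrow> bool" where
  "max_indep_over k A X \<longleftrightarrow> indep_over k A X \<and>
     (\<forall>Y. Y \<subseteq> {1..k} \<and> X \<subset> Y \<longrightarrow> \<not> indep_over k A Y)"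

definition fin_gen :: "nat \<Rightarrow> (nat \<Rightarrow> nat) set \<Rightarrow> bool" where
  "fin_gen k H \<longleftrightarrow> (\<exists>A. finite A \<and> A \<subseteq> H \<and> (\<lambda>S. submonoid S (natvec k)) hull A = H)"

definition min_gens :: "(nat \<Rightarrow> nat) set \<Rightarrow> (nat \<Rightarrow> nat) set" where
  "min_gens H = (H - {0}) - {x + y | x y. x \<in> H - {0} \<and> y \<in> H - {0}}"

lemma min_gens_subset_generators:
  assumes H: "submonoid H (natvec k)" and gen: "(\<lambda>S. submonoid S (natvec k)) hull A = H"
  shows "min_gens H \<subseteq> A"
proof
  fix b assume b: "b \<in> min_gens H"
  show "b \<in> A"
  proof (rule ccontr)
    assume "b \<notin> A"
    have sum: "x + y \<in> H - {b}" if "x \<in> H - {b}" "y \<in> H - {b}" for x y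
    proof -
      have "x + y \<in> H"
        using submonoid.m_closed[OF H, of x y] that by (simp add: natvec_def)
      moreover have "x + y \<noteq> b"
        using b that by (cases "x = 0"; cases "y = 0") (auto simp: min_gens_def)
      ultimately show ?thesis by simp
    qed
    have "submonoid (H - {b}) (natvec k)"
      using sum b submonoid.one_closed[OF H] submonoid.subset[OF H]
      by (intro submonoid.intro) (auto simp: natvec_def min_gens_def)
    moreover have "A \<subseteq> H - {b}"
      using \<open>b \<notin> A\<close> gen hull_subset[of A "\<lambda>S. submonoid S (natvec k)"] by auto
    ultimately have "H \<subseteq> H - {b}"
      using gen by (metis hull_minimal)
    then show False using b by (auto simp: min_gens_def)
  qed
qed

lemma finite_min_gens:
  assumes "submonoid H (natvec k)" "fin_gen k H"
  shows "finite (min_gens H)"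
  using assms min_gens_subset_generators finite_subset unfolding fin_gen_def by metis

definition monoid_dim :: "(nat \<Rightarrow> nat) set \<Rightarrow> nat" where
  "monoid_dim H = card (min_gens H)"

definition free_monoid :: "(nat \<Rightarrow> nat) set \<Rightarrow> bool" where
  "free_monoid F \<longleftrightarrow> (\<forall>x\<in>F. \<exists>!c :: (nat \<Rightarrow> nat) \<Rightarrow> nat.
     finite {b. c b \<noteq> 0} \<and> {b. c b \<noteq> 0} \<subseteq> min_gens F \<and>
     x = (\<lambda>i. \<Sum>b | c b \<noteq> 0. c b * b i))"

definition free_number :: "nat \<Rightarrow> (nat \<Rightarrow> nat) set \<Rightarrow> nat" where
  "free_number k H =
     Max {monoid_dim F | F. submonoid F (natvec k) \<and> F \<subseteq> H \<and> free_monoid F}"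

text \<open>
  The argument \<open>hs\<close> enumerates the minimal generators, which are the columns of the matrix.
  Matrix rows are numbered from \<open>0\<close>, coordinates from \<open>1\<close>.
\<close>

definition gen_matrix :: "nat \<Rightarrow> (nat \<Rightarrow> nat) list \<Rightarrow> rat mat" where
  "gen_matrix k hs = mat k (length hs) (\<lambda>(i, j). of_nat ((hs ! j) (Suc i)))"

end

theory Submission
  imports Defs
begin

text \<open>
  All the numbers in question equal the size of a largest finite set \<open>S \<subseteq> H\<close> whose combinations with
  natural coefficients are pairwise distinct; such sets are called \<open>nat_independent\<close>. This notion
  refers only to the addition of \<open>H\<close>, so it is invariant under isomorphism, and two inequalities
  tie it to the coordinates.

  In \<open>\<nat>\<^sup>r\<close> an independent set has at most \<open>r\<close> elements (\<open>card_nat_independent_le\<close>). The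
  reason is a count: the \<open>(N + 1)\<^sup>n\<close> combinations with coefficients up
  to \<open>N\<close> of \<open>n\<close> independent vectors are distinct, but they lie in a box with only \<open>O(N\<^sup>r)\<close> points.
  Every \<open>r\<close>-monoid isomorphic to \<open>H\<close> therefore bounds the size of the independent sets of \<open>H\<close>. One
  such monoid is the projection of \<open>H\<close> to the coordinates in \<open>X\<close>: by maximality of \<open>X\<close> the other
  coordinates are linear combinations of these, so the projection is injective.

  Conversely, if each \<open>h \<in> H\<close> is a rational combination of a finite set \<open>S\<close>, with coefficients
  \<open>q\<^sub>b(h)\<close>, then the \<open>i\<close>-th coordinate function on \<open>H\<close> is \<open>\<Sum>b\<in>S. b(i) q\<^sub>b\<close>. All coordinate functions
  thus lie in the span of the \<open>card S\<close> functions \<open>q\<^sub>b\<close>, and \<open>card X \<le> card S\<close>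
  (\<open>card_indep_le_of_rat_span\<close>). A largest independent set has this property, since any further element
  satisfies a nontrivial relation with it, which can be solved for that element. Hence the largest
  independent sets have exactly \<open>card X\<close> elements.

  The index, the free rank and the matrix rank follow. The lower bound on the index is the invariance
  above. A free submonoid has an independent set of minimal generators, and the combinations of an
  independent set form a free submonoid with that set as its minimal generators. Finally, the minimal
  generators that belong to a maximal linearly independent set of columns are independent, and
  every element of \<open>H\<close> is a rational combination of them, so there are again \<open>card X\<close> of them.
\<close>

section \<open>Combinations with natural coefficients\<close>

definition nat_comb :: "((nat \<Rightarrow> nat) \<Rightarrow> nat) \<Rightarrow> (nat \<Rightarrow> nat) set \<Rightarrow> nat \<Rightarrow> nat" where
  "nat_comb c S = (\<lambda>i. \<Sum>b\<in>S. c b * b i)"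

text \<open>
  For a finite set this amounts to linear independence over the rationals: a rational relation can be
  cleared of denominators and its negative terms moved to the other side. The form chosen here
  mentions no subtraction, so additive injections visibly preserve it.
\<close>

definition nat_independent :: "(nat \<Rightarrow> nat) set \<Rightarrow> bool" where
  "nat_independent S \<longleftrightarrow>
     finite S \<and> (\<forall>c c'. nat_comb c S = nat_comb c' S \<longrightarrow> (\<forall>b\<in>S. c b = c' b))"

lemma nat_independentD:
  "nat_independent S \<Longrightarrow> nat_comb c S = nat_comb c' S \<Longrightarrow> b \<in> S \<Longrightarrow> c b = c' b"
  by (auto simp: nat_independent_def)

lemma nat_independent_finite: "nat_independent S \<Longrightarrow> finite S"
  by (simp add: nat_independent_def)

lemma nat_comb_cong: "(\<And>b. b \<in> S \<Longrightarrow> c b = c' b) \<Longrightarrow> nat_comb c S = nat_comb c' S"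
  by (auto simp: nat_comb_def intro!: sum.cong)

lemma nat_comb_add: "nat_comb c S + nat_comb c' S = nat_comb (\<lambda>b. c b + c' b) S"
  by (simp add: nat_comb_def fun_eq_iff sum.distrib algebra_simps)

lemma nat_comb_zero: "nat_comb (\<lambda>_. 0) S = 0"
  by (simp add: nat_comb_def fun_eq_iff)

lemma nat_comb_unit: "finite S \<Longrightarrow> b \<in> S \<Longrightarrow> nat_comb (\<lambda>x. if x = b then 1 else 0) S = b"
  unfolding nat_comb_def by (intro ext) (simp add: if_distrib[of "\<lambda>x. x * _"] cong: if_cong)

lemma nat_comb_insert:
  "finite S \<Longrightarrow> b \<notin> S \<Longrightarrow> nat_comb c (insert b S) = (\<lambda>i. c b * b i) + nat_comb c S"
  by (simp add: nat_comb_def fun_eq_iff)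

lemma nat_comb_support:
  assumes "finite S" "{b. c b \<noteq> 0} \<subseteq> S"
  shows "(\<lambda>i. \<Sum>b | c b \<noteq> 0. c b * b i) = nat_comb c S"
  unfolding nat_comb_def using assms by (intro ext sum.mono_neutral_left) auto

lemma submonoid_natvec_iff:
  "submonoid H (natvec k) \<longleftrightarrow>
     (\<forall>h\<in>H. \<forall>i. i \<notin> {1..k} \<longrightarrow> h i = 0) \<and> 0 \<in> H \<and> (\<forall>x\<in>H. \<forall>y\<in>H. x + y \<in> H)"
  by (auto simp: submonoid_def natvec_def)

lemma submonoid_natvecD:
  assumes "submonoid H (natvec k)"
  shows "0 \<in> H" "\<And>x y. x \<in> H \<Longrightarrow> y \<in> H \<Longrightarrow> x + y \<in> H"
    "\<And>h i. h \<in> H \<Longrightarrow> i \<notin> {1..k} \<Longrightarrow> h i = 0"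
  using assms unfolding submonoid_natvec_iff by blast+

lemma scale_closed:
  fixes h :: "nat \<Rightarrow> nat"
  assumes "0 \<in> H" "\<And>x y. x \<in> H \<Longrightarrow> y \<in> H \<Longrightarrow> x + y \<in> H" "h \<in> H"
  shows "(\<lambda>i. n * h i) \<in> H"
proof (induction n)
  case 0
  then show ?case using assms(1) by (simp add: zero_fun_def)
next
  case (Suc n)
  have "(\<lambda>i. Suc n * h i) = h + (\<lambda>i. n * h i)" by (simp add: fun_eq_iff)
  then show ?case using assms(2)[OF assms(3) Suc] by simp
qed

lemma nat_comb_closed:
  assumes "0 \<in> H" "\<And>x y. x \<in> H \<Longrightarrow> y \<in> H \<Longrightarrow> x + y \<in> H" "finite S" "S \<subseteq> H"
  shows "nat_comb c S \<in> H"
  using assms(3,4)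
proof (induction S)
  case empty
  then show ?case using assms(1) by (simp add: nat_comb_def zero_fun_def)
next
  case (insert b S)
  then have "(\<lambda>i. c b * b i) + nat_comb c S \<in> H"
    by (intro assms(2) scale_closed[OF assms(1,2)]) auto
  then show ?case by (simp only: nat_comb_insert[OF insert.hyps])
qed

lemma zero_not_in_nat_independent:
  assumes "nat_independent S" shows "0 \<notin> S"
proof
  assume "0 \<in> S"
  have "nat_comb (\<lambda>_. 0) S = nat_comb (\<lambda>b. if b = 0 then 1 else 0) S"
    using nat_comb_unit[OF nat_independent_finite[OF assms] \<open>0 \<in> S\<close>] nat_comb_zero by simp
  from nat_independentD[OF assms this \<open>0 \<in> S\<close>] show False by simp
qed

section \<open>Bounding independent sets\<close>

text \<open>
  The left side grows in \<open>N\<close> like \<open>N\<^sup>n\<close> and the right side like \<open>N\<^sup>r\<close>.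
\<close>

lemma card_le_of_exponential_bound:
  fixes n r M :: nat
  assumes "\<And>N. (N + 1) ^ n \<le> (N * M + 1) ^ r"
  shows "n \<le> r"
proof (rule ccontr)
  assume "\<not> n \<le> r"
  then obtain d where n: "n = r + Suc d" using less_iff_Suc_add[of r n] by auto
  \<comment> \<open>Since \<open>N * M + 1 \<le> (N + 1) * (M + 1)\<close>, the hypothesis yields \<open>(N + 1) ^ (n - r) \<le> (M + 1) ^ r\<close>.\<close>
  define N where "N = (M + 1) ^ r"
  have "(N + 1) ^ r * (N + 1) \<le> (N + 1) ^ n"
    unfolding n power_add by (intro mult_left_mono self_le_power) auto
  also have "\<dots> \<le> (N * M + 1) ^ r" by (rule assms)
  also have "\<dots> \<le> ((N + 1) * (M + 1)) ^ r"
    by (rule power_mono) (auto simp: algebra_simps)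
  also have "\<dots> = (N + 1) ^ r * N"
    by (simp only: power_mult_distrib N_def)
  finally show False by simp
qed

text \<open>
  Coefficients up to \<open>N\<close> yield \<open>(N + 1) ^ card S\<close> distinct combinations, all of them in the box
  \<open>{0..N * M}\<^sup>r\<close>, where \<open>M\<close> bounds each coordinate of the sum of \<open>S\<close>.
\<close>

lemma card_nat_independent_le:
  assumes S: "nat_independent S" and r: "\<And>b i. b \<in> S \<Longrightarrow> i \<notin> {1..r} \<Longrightarrow> b i = 0"
  shows "card S \<le> r"
proof -
  note fin = nat_independent_finite[OF S]
  define M where "M = (\<Sum>i\<in>{1..r}. \<Sum>b\<in>S. b i)"
  have M: "(\<Sum>b\<in>S. b i) \<le> M" if "i \<in> {1..r}" for i
    unfolding M_def by (rule member_le_sum) (use that in auto)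
  have "(N + 1) ^ card S \<le> (N * M + 1) ^ r" for N
  proof -
    define C where "C = S \<rightarrow>\<^sub>E {..N}"
    define f where "f = (\<lambda>c. restrict (nat_comb c S) {1..r})"
    have "inj_on f C"
    proof (rule inj_onI)
      fix c c' assume c: "c \<in> C" "c' \<in> C" and eq: "f c = f c'"
      have "nat_comb c S i = nat_comb c' S i" for i
      proof (cases "i \<in> {1..r}")
        case True
        then show ?thesis using fun_cong[OF eq, of i] by (simp add: f_def)
      next
        case False
        then show ?thesis using r by (simp add: nat_comb_def)
      qed
      then have "c b = c' b" if "b \<in> S" for b
        using nat_independentD[OF S _ that] by blast
      then show "c = c'" using c unfolding C_def by (meson PiE_ext)
    qed
    moreover have "f ` C \<subseteq> {1..r} \<rightarrow>\<^sub>E {..N * M}"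
    proof (clarsimp simp: f_def)
      fix c i assume c: "c \<in> C" and i: "Suc 0 \<le> i" "i \<le> r"
      have "nat_comb c S i \<le> (\<Sum>b\<in>S. N * b i)"
        unfolding nat_comb_def by (rule sum_mono) (use c in \<open>auto simp: C_def\<close>)
      also have "\<dots> \<le> N * M" using M[of i] i by (simp flip: sum_distrib_left)
      finally show "nat_comb c S i \<le> N * M" .
    qed
    ultimately have "card C \<le> card ({1..r} \<rightarrow>\<^sub>E {..N * M})"
      by (intro card_inj_on_le) (auto intro: finite_PiE)
    then show ?thesis by (simp add: C_def card_PiE fin)
  qed
  then show ?thesis by (rule card_le_of_exponential_bound)
qed

lemma nat_comb_image:
  assumes zero: "0 \<in> H" and add: "\<And>x y. x \<in> H \<Longrightarrow> y \<in> H \<Longrightarrow> x + y \<in> H"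
    and hom: "\<And>x y. x \<in> H \<Longrightarrow> y \<in> H \<Longrightarrow> \<phi> (x + y) = \<phi> x + \<phi> y"
    and inj: "inj_on \<phi> H" and S: "finite S" "S \<subseteq> H"
  shows "nat_comb c (\<phi> ` S) = \<phi> (nat_comb (\<lambda>b. c (\<phi> b)) S)"
proof -
  have phi0: "\<phi> 0 = (0 :: nat \<Rightarrow> nat)" using hom[OF zero zero] by (auto simp: fun_eq_iff)
  have scale: "\<phi> (\<lambda>i. n * h i) = (\<lambda>i. n * \<phi> h i)" if h: "h \<in> H" for n h
  proof (induction n)
    case 0
    then show ?case using phi0 by (simp add: zero_fun_def)
  next
    case (Suc n)
    have "(\<lambda>i. Suc n * h i) = h + (\<lambda>i. n * h i)" by (simp add: fun_eq_iff)
    then have "\<phi> (\<lambda>i. Suc n * h i) = \<phi> h + (\<lambda>i. n * \<phi> h i)"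
      using hom[OF h scale_closed[OF zero add h, of n]] Suc by (simp only:)
    then show ?case by (simp add: fun_eq_iff)
  qed
  show ?thesis using S
  proof (induction S)
    case empty
    then show ?case using phi0 by (simp add: nat_comb_def zero_fun_def)
  next
    case (insert b S)
    have "\<phi> b \<notin> \<phi> ` S" using inj insert by (auto simp: inj_on_def)
    then have "nat_comb c (\<phi> ` insert b S) = (\<lambda>i. c (\<phi> b) * \<phi> b i) + nat_comb c (\<phi> ` S)"
      using insert by (simp add: nat_comb_insert)
    also have "\<dots> = \<phi> (\<lambda>i. c (\<phi> b) * b i) + \<phi> (nat_comb (\<lambda>b. c (\<phi> b)) S)"
      using insert scale by simp
    also have "\<dots> = \<phi> (nat_comb (\<lambda>b. c (\<phi> b)) (insert b S))"
      using insert hom[OF scale_closed[OF zero add] nat_comb_closed[OF zero add]]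
      by (simp add: nat_comb_insert)
    finally show ?case .
  qed
qed

text \<open>
  An isomorphism carries an independent set of \<open>H\<close> to one of the same size in \<open>\<nat>\<^sup>r\<close>, where the counting
  bound applies.
\<close>

lemma card_nat_independent_le_of_iso:
  assumes H: "submonoid H (natvec k)" and K: "submonoid K (natvec r)"
    and iso: "natvec k\<lparr>carrier := H\<rparr> \<cong> natvec r\<lparr>carrier := K\<rparr>"
    and S: "nat_independent S" "S \<subseteq> H"
  shows "card S \<le> r"
proof -
  note fin = nat_independent_finite[OF S(1)]
  note zero = submonoid_natvecD(1)[OF H] and add = submonoid_natvecD(2)[OF H]
  obtain \<phi> where bij: "bij_betw \<phi> H K"
    and hom: "\<And>x y. x \<in> H \<Longrightarrow> y \<in> H \<Longrightarrow> \<phi> (x + y) = \<phi> x + \<phi> y"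
    using iso by (auto simp: is_iso_def iso_def hom_def natvec_def)
  have inj: "inj_on \<phi> H" using bij by (rule bij_betw_imp_inj_on)
  have mem: "nat_comb c S \<in> H" for c
    using zero add fin S(2) by (rule nat_comb_closed)
  have "nat_independent (\<phi> ` S)"
    unfolding nat_independent_def
  proof (intro conjI allI impI)
    show "finite (\<phi> ` S)" using fin by simp
    fix c c' assume eq: "nat_comb c (\<phi> ` S) = nat_comb c' (\<phi> ` S)"
    have "\<phi> (nat_comb (\<lambda>b. c (\<phi> b)) S) = \<phi> (nat_comb (\<lambda>b. c' (\<phi> b)) S)"
      using eq nat_comb_image[OF zero add hom inj fin S(2)] by simp
    then have "nat_comb (\<lambda>b. c (\<phi> b)) S = nat_comb (\<lambda>b. c' (\<phi> b)) S"
      by (rule inj_onD[OF inj _ mem mem])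
    from nat_independentD[OF S(1) this] show "\<forall>b\<in>\<phi> ` S. c b = c' b" by simp
  qed
  moreover have "b i = 0" if "b \<in> \<phi> ` S" "i \<notin> {1..r}" for b i
  proof -
    have "b \<in> K" using that(1) S(2) bij by (auto simp: bij_betw_def)
    then show ?thesis using K that(2) by (auto simp: submonoid_natvec_iff)
  qed
  ultimately have "card (\<phi> ` S) \<le> r" by (rule card_nat_independent_le)
  then show ?thesis using card_image[OF inj_on_subset[OF inj S(2)]] by simp
qed

section \<open>Maximal independent coordinates\<close>

text \<open>
  A coordinate can fail to extend \<open>X\<close> in two ways: its function on \<open>H\<close> coincides with that of an
  element of \<open>X\<close>, or it depends linearly on the functions of \<open>X\<close>. Both put it in the span.
\<close>

lemma coord_in_span_max_indep:
  assumes X: "max_indep_over k H X" and j: "j \<in> {1..k}"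
  shows "coord H j \<in> ratfun.span (coord H ` X)"
proof (cases "coord H j \<in> coord H ` X")
  case True
  then show ?thesis by (rule ratfun.span_base)
next
  case False
  then have "X \<subset> insert j X" by auto
  moreover have ind: "X \<noteq> {}" "X \<subseteq> {1..k}" "inj_on (coord H) X" "ratfun.independent (coord H ` X)"
    using X by (auto simp: max_indep_over_def indep_over_def)
  moreover have "insert j X \<subseteq> {1..k}" using ind(2) j by simp
  moreover have "\<And>Y. Y \<subseteq> {1..k} \<Longrightarrow> X \<subset> Y \<Longrightarrow> \<not> indep_over k H Y"
    using X by (simp add: max_indep_over_def)
  ultimately have "\<not> indep_over k H (insert j X)" by simp
  then have "ratfun.dependent (insert (coord H j) (coord H ` X))"
    using ind j False unfolding indep_over_def by (auto simp: inj_on_insert)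
  then show ?thesis using ind(4) ratfun.independent_insertI by blast
qed

text \<open>
  Two points at which all functions of a family agree are also not separated by its linear span.
\<close>

lemma max_indep_determines:
  assumes H: "submonoid H (natvec k)" and X: "max_indep_over k H X"
    and h: "h \<in> H" "h' \<in> H" and eq: "\<And>i. i \<in> X \<Longrightarrow> h i = h' i"
  shows "h = h'"
proof
  fix j
  show "h j = h' j"
  proof (cases "j \<in> {1..k}")
    case True
    have "ratfun.subspace {F. F h = F h'}"
      by (auto simp: ratfun.subspace_def ratfun_scale_def)
    moreover have "coord H ` X \<subseteq> {F. F h = F h'}"
      using h eq by (auto simp: coord_def)
    ultimately have "coord H j \<in> {F. F h = F h'}"
      using coord_in_span_max_indep[OF X True] ratfun.span_minimal by blast
    then show ?thesis using h by (simp add: coord_def)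
  next
    case False
    then show ?thesis
      using submonoid_natvecD(3)[OF H h(1) False] submonoid_natvecD(3)[OF H h(2) False] by simp
  qed
qed

text \<open>
  The projection to the coordinates in \<open>X\<close>, renumbered as \<open>1, \<dots>, card X\<close>, is injective on \<open>H\<close>.
\<close>

lemma iso_card_max_indep:
  assumes H: "submonoid H (natvec k)" and X: "max_indep_over k H X"
  shows "\<exists>K. submonoid K (natvec (card X)) \<and>
    natvec k\<lparr>carrier := H\<rparr> \<cong> natvec (card X)\<lparr>carrier := K\<rparr>"
proof -
  have "finite X" using X by (auto simp: max_indep_over_def indep_over_def intro: finite_subset)
  then obtain e where e: "bij_betw e {1..card X} X"
    using ex_bij_betw_nat_finite_1 by blast
  define \<rho> :: "(nat \<Rightarrow> nat) \<Rightarrow> nat \<Rightarrow> nat"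
    where "\<rho> = (\<lambda>h i. if i \<in> {1..card X} then h (e i) else 0)"
  have hom: "\<rho> (x + y) = \<rho> x + \<rho> y" for x y by (auto simp: \<rho>_def)
  have inj: "inj_on \<rho> H"
  proof (rule inj_onI)
    fix h h' assume h: "h \<in> H" "h' \<in> H" and eq: "\<rho> h = \<rho> h'"
    show "h = h'"
    proof (rule max_indep_determines[OF H X h])
      fix i assume "i \<in> X"
      then have "i \<in> e ` {1..card X}" using bij_betw_imp_surj_on[OF e] by simp
      then obtain a where "a \<in> {1..card X}" "e a = i" by (elim imageE) auto
      then show "h i = h' i" using fun_cong[OF eq, of a] by (simp add: \<rho>_def)
    qed
  qed
  have "submonoid (\<rho> ` H) (natvec (card X))"
    unfolding submonoid_natvec_iff
  proof (intro conjI ballI)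
    show "0 \<in> \<rho> ` H"
      using H by (intro image_eqI[of _ _ 0]) (auto simp: \<rho>_def submonoid_natvec_iff fun_eq_iff)
    fix x y assume "x \<in> \<rho> ` H" "y \<in> \<rho> ` H"
    then show "x + y \<in> \<rho> ` H"
      using H by (auto simp: submonoid_natvec_iff simp flip: hom)
  qed (auto simp: \<rho>_def)
  moreover have "\<rho> \<in> iso (natvec k\<lparr>carrier := H\<rparr>) (natvec (card X)\<lparr>carrier := \<rho> ` H\<rparr>)"
    using inj hom by (auto simp: iso_def hom_def natvec_def bij_betw_def)
  ultimately show ?thesis by (auto simp: is_iso_def)
qed

lemma card_nat_independent_le_max_indep:
  assumes "submonoid H (natvec k)" "max_indep_over k H X" "nat_independent S" "S \<subseteq> H"
  shows "card S \<le> card X"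
  using iso_card_max_indep[OF assms(1,2)] card_nat_independent_le_of_iso[OF assms(1) _ _ assms(3,4)]
  by blast

section \<open>Rational combinations\<close>

definition rat_span :: "(nat \<Rightarrow> nat) set \<Rightarrow> (nat \<Rightarrow> nat) set" where
  "rat_span S = {h. \<exists>q :: (nat \<Rightarrow> nat) \<Rightarrow> rat. \<forall>i. of_nat (h i) = (\<Sum>b\<in>S. q b * of_nat (b i))}"

lemma rat_span_zero: "0 \<in> rat_span S"
  unfolding rat_span_def by (auto intro!: exI[of _ "\<lambda>_. 0"])

lemma rat_span_add:
  assumes "x \<in> rat_span S" "y \<in> rat_span S"
  shows "x + y \<in> rat_span S"
proof -
  obtain p q :: "(nat \<Rightarrow> nat) \<Rightarrow> rat"
    where p: "\<And>i. of_nat (x i) = (\<Sum>b\<in>S. p b * of_nat (b i))"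
      and q: "\<And>i. of_nat (y i) = (\<Sum>b\<in>S. q b * of_nat (b i))"
    using assms unfolding rat_span_def by blast
  show ?thesis
    unfolding rat_span_def
    by (intro CollectI exI[of _ "\<lambda>b. p b + q b"] allI) (simp add: p q sum.distrib algebra_simps)
qed

text \<open>
  Row rank is at most column rank: choosing coefficients \<open>q\<close> that express each \<open>h \<in> H\<close> in terms of
  \<open>S\<close> also expresses each coordinate function in terms of the functions \<open>h \<mapsto> q h b\<close> for \<open>b \<in> S\<close>.
\<close>

lemma card_indep_le_of_rat_span:
  assumes X: "indep_over k H X" and S: "finite S" and span: "H \<subseteq> rat_span S"
  shows "card X \<le> card S"
proof -
  from span have "\<forall>h. \<exists>q :: (nat \<Rightarrow> nat) \<Rightarrow> rat. h \<in> H \<longrightarrow>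
      (\<forall>i. of_nat (h i) = (\<Sum>b\<in>S. q b * of_nat (b i)))"
    unfolding rat_span_def by blast
  then obtain q :: "(nat \<Rightarrow> nat) \<Rightarrow> (nat \<Rightarrow> nat) \<Rightarrow> rat"
    where q: "\<And>h i. h \<in> H \<Longrightarrow> of_nat (h i) = (\<Sum>b\<in>S. q h b * of_nat (b i))"
    by metis
  \<comment> \<open>Functions on \<open>H\<close> are represented by their extension by zero.\<close>
  define Q where "Q b = (\<lambda>h. if h \<in> H then q h b else 0)" for b
  have sum_apply: "(\<Sum>b\<in>S. G b) h = (\<Sum>b\<in>S. G b h)" for G :: "(nat \<Rightarrow> nat) \<Rightarrow> (nat \<Rightarrow> nat) \<Rightarrow> rat" and h
    using S by (induction S) auto
  have "coord H i = (\<Sum>b\<in>S. ratfun_scale (of_nat (b i)) (Q b))" for i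
    by (auto simp: fun_eq_iff sum_apply ratfun_scale_def Q_def coord_def q mult.commute)
  then have "coord H ` X \<subseteq> ratfun.span (Q ` S)"
    by (auto intro!: ratfun.span_sum ratfun.span_scale intro: ratfun.span_base)
  then have "card (coord H ` X) \<le> card (Q ` S)"
    using ratfun.independent_span_bound[of "Q ` S" "coord H ` X"] X S
    by (simp add: indep_over_def)
  also have "\<dots> \<le> card S" using S by (rule card_image_le)
  finally show ?thesis using X by (simp add: card_image indep_over_def)
qed

text \<open>
  Two different combinations with the same value must differ in the coefficient of \<open>h\<close>, for otherwise
  cancelling \<open>h\<close> leaves a relation in \<open>S\<close>; so their difference can be solved for \<open>h\<close>.
\<close>

lemma in_rat_span_of_not_nat_independent:
  assumes S: "nat_independent S" and h: "\<not> nat_independent (insert h S)"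
  shows "h \<in> rat_span S"
proof -
  note fin = nat_independent_finite[OF S]
  have hS: "h \<notin> S" using S h by (auto simp: insert_absorb)
  obtain c c' b where eq: "nat_comb c (insert h S) = nat_comb c' (insert h S)"
    and b: "b \<in> insert h S" "c b \<noteq> c' b"
    using h fin by (auto simp: nat_independent_def)
  have eq': "c h * h i + nat_comb c S i = c' h * h i + nat_comb c' S i" for i
    using fun_cong[OF eq, of i] by (simp add: nat_comb_insert[OF fin hS])
  have ne: "c h \<noteq> c' h"
  proof
    assume ch: "c h = c' h"
    then have "nat_comb c S = nat_comb c' S" using eq' by (auto simp: fun_eq_iff)
    from nat_independentD[OF S this] b ch show False by auto
  qed
  define d :: rat where "d = of_nat (c h) - of_nat (c' h)"
  have d: "d \<noteq> 0" using ne by (simp add: d_def)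
  have "of_nat (h i) = (\<Sum>b\<in>S. (of_nat (c' b) - of_nat (c b)) / d * of_nat (b i))" for i
  proof -
    have "of_nat (c h) * of_nat (h i) + of_nat (nat_comb c S i)
        = (of_nat (c' h) * of_nat (h i) + of_nat (nat_comb c' S i) :: rat)"
      using eq'[of i] by (metis of_nat_add of_nat_mult)
    then have "d * of_nat (h i) = of_nat (nat_comb c' S i) - of_nat (nat_comb c S i)"
      by (simp add: d_def algebra_simps)
    also have "\<dots> = (\<Sum>b\<in>S. (of_nat (c' b) - of_nat (c b)) * of_nat (b i))"
      by (simp add: nat_comb_def sum_subtractf algebra_simps)
    finally have "of_nat (h i) = (\<Sum>b\<in>S. (of_nat (c' b) - of_nat (c b)) * of_nat (b i)) / d"
      using d by (simp add: field_simps)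
    then show ?thesis by (simp add: sum_divide_distrib)
  qed
  then show ?thesis
    unfolding rat_span_def
    by (intro CollectI exI[of _ "\<lambda>b. (of_nat (c' b) - of_nat (c b)) / d"] allI)
qed

text \<open>
  The sizes of independent subsets of \<open>H\<close> are bounded by \<open>card X\<close>, so there is a largest one. No
  element of \<open>H\<close> extends it, hence \<open>H\<close> lies in its rational span, which gives the reverse inequality.
\<close>

lemma ex_nat_independent_card_max_indep:
  assumes H: "submonoid H (natvec k)" and X: "max_indep_over k H X"
  shows "\<exists>S. nat_independent S \<and> S \<subseteq> H \<and> card S = card X"
proof -
  define P where "P S \<longleftrightarrow> nat_independent S \<and> S \<subseteq> H" for S
  have bound: "card S \<le> card X" if "P S" for S
    using card_nat_independent_le_max_indep[OF H X] that by (auto simp: P_def)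
  have "P {}" by (simp add: P_def nat_independent_def)
  then obtain S where S: "P S" and max: "\<And>T. P T \<Longrightarrow> card T \<le> card S"
    using ex_has_greatest_nat[of P "{}" card "Suc (card X)"] bound by (auto simp: le_imp_less_Suc)
  note fin = nat_independent_finite
  have "H \<subseteq> rat_span S"
  proof
    fix h assume h: "h \<in> H"
    show "h \<in> rat_span S"
    proof (cases "h \<in> S")
      case True
      have "finite S" using S fin by (auto simp: P_def)
      then show ?thesis using True
        unfolding rat_span_def
        by (auto intro!: exI[of _ "\<lambda>b. if b = h then 1 else 0"]
            simp: if_distrib[of "\<lambda>x. x * _"] cong: if_cong)
    next
      case False
      have "\<not> nat_independent (insert h S)"
        using max[of "insert h S"] S h False fin by (auto simp: P_def)
      then show ?thesis using S in_rat_span_of_not_nat_independent by (auto simp: P_def)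
    qed
  qed
  then have "card X \<le> card S"
    using card_indep_le_of_rat_span X S fin by (auto simp: P_def max_indep_over_def)
  then show ?thesis using S bound[OF S] by (auto simp: P_def)
qed

section \<open>Free submonoids\<close>

text \<open>
  By uniqueness of coefficients, a decomposition of \<open>b \<in> S\<close> into two combinations has total
  coefficient one at \<open>b\<close> and zero elsewhere, so one summand vanishes. Any other nonzero combination
  splits off an element of \<open>S\<close>.
\<close>

lemma min_gens_nat_span:
  assumes S: "nat_independent S"
  shows "min_gens (range (\<lambda>c. nat_comb c S)) = S"
proof (intro equalityI subsetI)
  note fin = nat_independent_finite[OF S]
  let ?F = "range (\<lambda>c. nat_comb c S)"
  {
    fix x assume x: "x \<in> min_gens ?F"
    then obtain c where c: "x = nat_comb c S" and "x \<noteq> 0" by (auto simp: min_gens_def)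
    then obtain b where b: "b \<in> S" "c b \<noteq> 0"
      using nat_comb_cong[of S c "\<lambda>_. 0"] nat_comb_zero by metis
    define y where "y = nat_comb (\<lambda>a. c a - (if a = b then 1 else 0)) S"
    have bF: "b \<in> ?F" using nat_comb_unit[OF fin b(1)] by (metis rangeI)
    have "b + y = nat_comb (\<lambda>a. (if a = b then 1 else 0) + (c a - (if a = b then 1 else 0))) S"
      unfolding y_def nat_comb_add[symmetric] nat_comb_unit[OF fin b(1)] ..
    also have "\<dots> = x" unfolding c using b by (intro nat_comb_cong) auto
    finally have x_eq: "x = b + y" by simp
    have "b \<noteq> 0" using zero_not_in_nat_independent[OF S] b by auto
    then have "y = 0" using x x_eq bF unfolding min_gens_def y_def by blast
    then show "x \<in> S" using x_eq b by simp
  next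
    fix b assume b: "b \<in> S"
    have "b \<noteq> 0" using zero_not_in_nat_independent[OF S] b by auto
    moreover have "b \<in> ?F" using nat_comb_unit[OF fin b] by (metis rangeI)
    moreover have "x = 0 \<or> y = 0" if F: "x \<in> ?F" "y \<in> ?F" and b_eq: "b = x + y" for x y
    proof -
      obtain c c' where c: "x = nat_comb c S" "y = nat_comb c' S" using F by auto
      have "nat_comb (\<lambda>a. c a + c' a) S = nat_comb (\<lambda>a. if a = b then 1 else 0) S"
        using b_eq c nat_comb_unit[OF fin b] by (simp add: nat_comb_add)
      from nat_independentD[OF S this]
      have *: "c a + c' a = (if a = b then 1 else 0)" if "a \<in> S" for a using that by blast
      have "(\<forall>a\<in>S. c a = 0) \<or> (\<forall>a\<in>S. c' a = 0)"
      proof (cases "c b = 0")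
        case True
        then have "\<forall>a\<in>S. c a = 0" using * by (metis add_is_0)
        then show ?thesis ..
      next
        case False
        then have "c' b = 0" using *[OF b] by simp
        then have "\<forall>a\<in>S. c' a = 0" using * by (metis add_is_0)
        then show ?thesis ..
      qed
      then show ?thesis
        unfolding c using nat_comb_cong[of S _ "\<lambda>_. 0"] nat_comb_zero by metis
    qed
    ultimately show "b \<in> min_gens ?F" unfolding min_gens_def by blast
  }
qed

lemma free_monoid_nat_span:
  assumes S: "nat_independent S"
  shows "free_monoid (range (\<lambda>c. nat_comb c S))"
  unfolding free_monoid_def min_gens_nat_span[OF S]
proof
  note fin = nat_independent_finite[OF S]
  fix x assume "x \<in> range (\<lambda>c. nat_comb c S)"
  then obtain c0 where c0: "x = nat_comb c0 S" by auto
  define c where "c = (\<lambda>b. if b \<in> S then c0 b else 0)"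
  have supp: "{b. c b \<noteq> 0} \<subseteq> S" by (auto simp: c_def)
  have x: "x = nat_comb c S" unfolding c0 by (rule nat_comb_cong) (simp add: c_def)
  show "\<exists>!c. finite {b. c b \<noteq> 0} \<and> {b. c b \<noteq> 0} \<subseteq> S \<and> x = (\<lambda>i. \<Sum>b | c b \<noteq> 0. c b * b i)"
  proof (rule ex1I[of _ c])
    show "finite {b. c b \<noteq> 0} \<and> {b. c b \<noteq> 0} \<subseteq> S \<and> x = (\<lambda>i. \<Sum>b | c b \<noteq> 0. c b * b i)"
      using supp fin x nat_comb_support[OF fin supp] finite_subset by auto
  next
    fix d assume d: "finite {b. d b \<noteq> 0} \<and> {b. d b \<noteq> 0} \<subseteq> S \<and> x = (\<lambda>i. \<Sum>b | d b \<noteq> 0. d b * b i)"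
    then have "nat_comb d S = nat_comb c S" using nat_comb_support[OF fin, of d] x by simp
    from nat_independentD[OF S this] show "d = c"
      using d by (auto simp: c_def fun_eq_iff)
  qed
qed

text \<open>
  The definition of freeness speaks of finitely supported coefficient functions on the whole type.
  Coefficients on \<open>T\<close> are therefore extended by zero before uniqueness is applied.
\<close>

lemma nat_independent_min_gens_free:
  assumes F: "submonoid F (natvec k)" and free: "free_monoid F"
    and T: "finite T" "T \<subseteq> min_gens F"
  shows "nat_independent T"
  unfolding nat_independent_def
proof (intro conjI allI impI)
  show "finite T" by fact
  fix c c' assume eq: "nat_comb c T = nat_comb c' T"
  have "T \<subseteq> F" using T by (auto simp: min_gens_def)
  then have mem: "nat_comb c T \<in> F"
    using F T nat_comb_closed[of F T c] by (auto simp: submonoid_natvec_iff)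
  define ext where "ext d = (\<lambda>b. if b \<in> T then d b else 0)" for d :: "(nat \<Rightarrow> nat) \<Rightarrow> nat"
  have supp: "{b. ext d b \<noteq> 0} \<subseteq> T" for d by (auto simp: ext_def)
  have "nat_comb (ext d) T = nat_comb d T" for d
    by (rule nat_comb_cong) (simp add: ext_def)
  then have val: "(\<lambda>i. \<Sum>b | ext d b \<noteq> 0. ext d b * b i) = nat_comb d T" for d
    using nat_comb_support[OF T(1) supp] by simp
  define Q where "Q d \<longleftrightarrow> finite {b. d b \<noteq> 0} \<and> {b. d b \<noteq> 0} \<subseteq> min_gens F \<and>
    nat_comb c T = (\<lambda>i. \<Sum>b | d b \<noteq> 0. d b * b i)" for d :: "(nat \<Rightarrow> nat) \<Rightarrow> nat"
  have "\<exists>!d. Q d" using free mem unfolding free_monoid_def Q_def by (rule bspec)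
  moreover have "Q (ext d)" if "nat_comb d T = nat_comb c T" for d
    unfolding Q_def val that using finite_subset[OF supp T(1)] subset_trans[OF supp T(2)] by simp
  ultimately have "ext c = ext c'" using eq by auto
  then show "\<forall>b\<in>T. c b = c' b" unfolding ext_def by meson
qed

text \<open>
  If the minimal generators form an infinite set, then \<open>monoid_dim\<close> is zero by the convention for
  \<open>card\<close>, and the bound is trivial.
\<close>

lemma monoid_dim_free_le:
  assumes H: "submonoid H (natvec k)" and X: "max_indep_over k H X"
    and F: "submonoid F (natvec k)" "F \<subseteq> H" "free_monoid F"
  shows "monoid_dim F \<le> card X"
proof (cases "finite (min_gens F)")
  case True
  moreover have "min_gens F \<subseteq> H" using F(2) by (auto simp: min_gens_def)
  ultimately show ?thesis
    unfolding monoid_dim_def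
    using card_nat_independent_le_max_indep[OF H X] nat_independent_min_gens_free[OF F(1,3)] by blast
qed (simp add: monoid_dim_def)

lemma free_number_eq_card:
  assumes H: "submonoid H (natvec k)" and X: "max_indep_over k H X"
  shows "free_number k H = card X"
proof -
  let ?D = "{monoid_dim F | F. submonoid F (natvec k) \<and> F \<subseteq> H \<and> free_monoid F}"
  have le: "n \<le> card X" if "n \<in> ?D" for n
    using that monoid_dim_free_le[OF H X] by auto
  obtain S where S: "nat_independent S" "S \<subseteq> H" "card S = card X"
    using ex_nat_independent_card_max_indep[OF H X] by blast
  let ?F = "range (\<lambda>c. nat_comb c S)"
  note zero = submonoid_natvecD(1)[OF H] and add = submonoid_natvecD(2)[OF H]
    and outside = submonoid_natvecD(3)[OF H]
  have sub: "?F \<subseteq> H"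
    using zero add nat_independent_finite[OF S(1)] S(2)
    by (intro image_subsetI nat_comb_closed) auto
  moreover have "submonoid ?F (natvec k)"
    unfolding submonoid_natvec_iff
  proof (intro conjI)
    show "\<forall>h\<in>?F. \<forall>i. i \<notin> {1..k} \<longrightarrow> h i = 0"
      by (intro ballI allI impI outside) (rule subsetD[OF sub])
    show "0 \<in> ?F" using nat_comb_zero[of S] by (metis rangeI)
    show "\<forall>x\<in>?F. \<forall>y\<in>?F. x + y \<in> ?F"
      unfolding ball_simps nat_comb_add by blast
  qed
  moreover have "monoid_dim ?F = card X"
    using S by (simp add: monoid_dim_def min_gens_nat_span)
  ultimately have "card X \<in> ?D"
    using free_monoid_nat_span[OF S(1)] by (intro CollectI exI[of _ ?F]) simp
  then show ?thesis
    unfolding free_number_def using le by (intro Max_eqI) (auto intro: finite_subset[of _ "{..card X}"])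
qed

section \<open>The index\<close>

lemma ind_eq_card:
  assumes H: "submonoid H (natvec k)" and X: "max_indep_over k H X"
  shows "ind k H = card X"
  unfolding ind_def
proof (rule Least_equality)
  have "finite X" "X \<noteq> {}"
    using X by (auto simp: max_indep_over_def indep_over_def intro: finite_subset)
  then have "1 \<le> card X" by (simp add: Suc_le_eq card_gt_0_iff)
  then show "1 \<le> card X \<and> (\<exists>K. submonoid K (natvec (card X)) \<and>
      natvec k\<lparr>carrier := H\<rparr> \<cong> natvec (card X)\<lparr>carrier := K\<rparr>)"
    using iso_card_max_indep[OF H X] by blast
  fix r assume "1 \<le> r \<and> (\<exists>K. submonoid K (natvec r) \<and>
      natvec k\<lparr>carrier := H\<rparr> \<cong> natvec r\<lparr>carrier := K\<rparr>)"
  then show "card X \<le> r"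
    using ex_nat_independent_card_max_indep[OF H X] card_nat_independent_le_of_iso[OF H] by metis
qed

section \<open>The rank of the generator matrix\<close>

text \<open>
  The minimal generators generate \<open>H\<close>, because an element that is neither zero nor a minimal generator
  is a sum of two elements of \<open>H\<close> with smaller coordinate sums.
\<close>

lemma min_gens_induct:
  assumes H: "submonoid H (natvec k)" and h: "h \<in> H"
    and zero: "P 0" and gen: "\<And>b. b \<in> min_gens H \<Longrightarrow> P b"
    and add: "\<And>x y. P x \<Longrightarrow> P y \<Longrightarrow> P (x + y)"
  shows "P h"
  using h
proof (induction "\<Sum>i\<in>{1..k}. h i" arbitrary: h rule: less_induct)
  case less
  show ?case
  proof (cases "h = 0 \<or> h \<in> min_gens H")
    case True
    then show ?thesis using zero gen by auto
  next
    case False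
    then obtain x y where xy: "x \<in> H" "y \<in> H" "x \<noteq> 0" "y \<noteq> 0" "h = x + y"
      using less.prems by (auto simp: min_gens_def)
    have pos: "0 < (\<Sum>i\<in>{1..k}. z i)" if "z \<in> H" "z \<noteq> 0" for z
    proof (rule ccontr)
      assume "\<not> 0 < (\<Sum>i\<in>{1..k}. z i)"
      then have "\<forall>i\<in>{1..k}. z i = 0" by simp
      then have "z = 0" using H that(1) by (auto simp: submonoid_natvec_iff fun_eq_iff)
      then show False using that(2) by simp
    qed
    have "(\<Sum>i\<in>{1..k}. h i) = (\<Sum>i\<in>{1..k}. x i) + (\<Sum>i\<in>{1..k}. y i)"
      by (simp add: xy(5) sum.distrib)
    then show ?thesis
      using pos[OF xy(1,3)] pos[OF xy(2,4)] less.hyps xy add by simp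
  qed
qed

text \<open>
  A maximal linearly independent set of columns corresponds to a set \<open>S\<close> of minimal generators, and its
  size is the rank. Equal natural combinations of \<open>S\<close> would give a linear relation between the
  columns, so \<open>S\<close> is independent and has at most \<open>card X\<close> elements. By maximality the remaining
  columns lie in the span, hence all of \<open>H\<close> is in the rational span of \<open>S\<close>, and \<open>card X \<le> card S\<close>.
\<close>

lemma rank_gen_matrix_eq_card:
  assumes H: "submonoid H (natvec k)" and X: "max_indep_over k H X"
    and hs: "set hs = min_gens H"
  shows "vec_space.rank k (gen_matrix k hs) = card X"
proof -
  interpret V: vec_space "TYPE(rat)" k .
  define col :: "(nat \<Rightarrow> nat) \<Rightarrow> rat vec" where "col h = vec k (\<lambda>i. of_nat (h (Suc i)))" for h
  have dim: "gen_matrix k hs \<in> carrier_mat k (length hs)" by (simp add: gen_matrix_def)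
  have "cols (gen_matrix k hs) = map col hs"
    by (rule nth_equalityI) (auto simp: gen_matrix_def col_def)
  then have cols: "set (cols (gen_matrix k hs)) = col ` min_gens H" using hs by simp
  have inj: "inj_on col H"
  proof (rule inj_onI)
    fix h h' assume h: "h \<in> H" "h' \<in> H" and eq: "col h = col h'"
    show "h = h'"
    proof
      fix j
      show "h j = h' j"
      proof (cases "j \<in> {1..k}")
        case True
        then have "j - 1 < k" "Suc (j - 1) = j" by auto
        then show ?thesis
          using arg_cong[OF eq, of "\<lambda>v. v $ (j - 1)"] by (simp add: col_def)
      next
        case False
        then show ?thesis
          using submonoid_natvecD(3)[OF H h(1) False] submonoid_natvecD(3)[OF H h(2) False] by simp
      qed
    qed
  qed
  have "V.lin_indpt {}"
    by (rule V.finite_lin_indpt2) auto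
  then obtain U where U: "maximal U (\<lambda>T. T \<subseteq> col ` min_gens H \<and> V.lin_indpt T)"
    using maximal_exists_superset[of "col ` min_gens H"
        "\<lambda>T. T \<subseteq> col ` min_gens H \<and> V.lin_indpt T" "{}"] hs[symmetric] by auto
  have rank: "V.rank (gen_matrix k hs) = card U"
    using V.rank_card_indpt[OF dim] U cols by simp
  define S where "S = {h \<in> min_gens H. col h \<in> U}"
  have gensH: "min_gens H \<subseteq> H" by (auto simp: min_gens_def)
  have SH: "S \<subseteq> H" using gensH by (auto simp: S_def)
  have "finite (min_gens H)" unfolding hs[symmetric] by simp
  then have finS: "finite S" by (simp add: S_def)
  have U_eq: "U = col ` S" using U by (auto simp: maximal_def S_def)
  have injS: "inj_on col S" using inj SH by (rule inj_on_subset)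
  have Uc: "U \<subseteq> carrier_vec k" by (auto simp: U_eq col_def)
  have ind: "V.lin_indpt U" using U by (auto simp: maximal_def)
  have lincomb: "V.lincomb a U $ i = (\<Sum>b\<in>S. a (col b) * of_nat (b (Suc i)))" if "i < k" for a i
  proof -
    have "V.lincomb a U $ i = (\<Sum>v\<in>col ` S. a v * v $ i)"
      using V.lincomb_index[OF that Uc, of a] U_eq by simp
    also have "\<dots> = (\<Sum>b\<in>S. a (col b) * col b $ i)"
      by (simp add: sum.reindex[OF injS])
    finally show ?thesis using that by (simp add: col_def)
  qed
  have "nat_independent S"
    unfolding nat_independent_def
  proof (intro conjI allI impI finS)
    fix c c' assume eq: "nat_comb c S = nat_comb c' S"
    \<comment> \<open>The difference of the two coefficient functions, as a function of the column.\<close>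
    define a where "a v = (of_nat (c (inv_into S col v)) - of_nat (c' (inv_into S col v)) :: rat)" for v
    have a: "a (col h) = of_nat (c h) - of_nat (c' h)" if "h \<in> S" for h
      using that injS by (simp add: a_def)
    have "V.lincomb a U = 0\<^sub>v k"
    proof (rule eq_vecI)
      fix i assume i: "i < dim_vec (0\<^sub>v k :: rat vec)"
      have "V.lincomb a U $ i = of_nat (nat_comb c S (Suc i)) - of_nat (nat_comb c' S (Suc i))"
        using i by (simp add: lincomb a nat_comb_def sum_subtractf algebra_simps)
      then show "V.lincomb a U $ i = 0\<^sub>v k $ i" using i eq by simp
    qed (use V.lincomb_dim[OF _ Uc] finS U_eq in simp)
    then have "a (col b) = 0" if "b \<in> S" for b
      using V.not_lindepD[OF ind _ order_refl, of a] that finS U_eq by auto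
    then show "\<forall>b\<in>S. c b = c' b" using a by simp
  qed
  then have le: "card S \<le> card X" using card_nat_independent_le_max_indep[OF H X] SH by blast
  have gen: "h \<in> rat_span S" if h: "h \<in> min_gens H" for h
  proof -
    have hc: "col h \<in> carrier_vec k" by (simp add: col_def)
    have "col h \<in> V.span U"
    proof (cases "col h \<in> U")
      case True
      then show ?thesis using V.span_mem[OF Uc] by blast
    next
      case False
      then have "V.lin_dep (U \<union> {col h})" using U h by (auto simp: maximal_def)
      then show ?thesis using V.lin_dep_iff_in_span[OF _ ind _ False] Uc hc by simp
    qed
    then obtain a where a: "V.lincomb a U = col h"
      using V.finite_in_span[of U "col h"] Uc finS U_eq by auto
    have "of_nat (h j) = (\<Sum>b\<in>S. a (col b) * of_nat (b j))" for j
    proof (cases "j \<in> {1..k}")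
      case True
      then have "j - 1 < k" "Suc (j - 1) = j" by auto
      then show ?thesis using lincomb[of "j - 1" a] a by (simp add: col_def)
    next
      case False
      have "z j = 0" if "z \<in> H" for z using that submonoid_natvecD(3)[OF H _ False] by simp
      then show ?thesis using h gensH SH by (simp add: subset_iff)
    qed
    then show ?thesis unfolding rat_span_def by (auto intro!: exI[of _ "\<lambda>b. a (col b)"])
  qed
  have "H \<subseteq> rat_span S"
    using min_gens_induct[OF H, of _ "\<lambda>h. h \<in> rat_span S"] rat_span_zero gen rat_span_add by blast
  then have "card X \<le> card S"
    using card_indep_le_of_rat_span X finS by (auto simp: max_indep_over_def)
  then show ?thesis using le rank card_image[OF injS] U_eq by simp
qed

theorem theorem2p8:
  fixes k :: nat and H :: "(nat \<Rightarrow> nat) set" and X :: "nat set"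
  assumes "1 \<le> k"
    and "submonoid H (natvec k)"
    and "H \<noteq> {0}"
    and "max_indep_over k H X"
  shows "ind k H = card X \<and> card X = free_number k H \<and>
    (fin_gen k H \<longrightarrow> (\<forall>hs. distinct hs \<and> set hs = min_gens H \<longrightarrow>
       ind k H = vec_space.rank k (gen_matrix k hs)))"
  using ind_eq_card free_number_eq_card rank_gen_matrix_eq_card assms(2,4) by metis

end
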